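(* Let $\alpha>0$, $0\leqslant\rho\leqslant1$ and $\boldsymbol{\theta}=(\sigma,\alpha,\rho)^\top$ with $\sigma=1$. Then the unit-Fréchet probability density function $f_W(\cdot\,;\boldsymbol{\theta})$ is symmetric around $w=1/2$, that is, $$f_W\left(\tfrac12-\delta;\boldsymbol{\theta}\right)=f_W\left(\tfrac12+\delta;\boldsymbol{\theta}\right)\qquad\text{for all } 0<\delta<\tfrac12.$$
   Context: For $\boldsymbol{\theta}=(\sigma,\alpha,\rho)^\top$ with $\sigma>0$, $\alpha>0$, $0\leqslant\rho\leqslant1$, the probability density function (PDF) of the unit-Fréchet distribution ${\rm UF}(\boldsymbol{\theta})$ on $(0,1)$ is, for $0<w<1$, $$f_W(w;\boldsymbol{\theta})=\frac{\alpha}{\sigma^\alpha}\,s^{\alpha-1}(s+1)^2\left\{\frac{2\left(\frac{s^\alpha}{\sigma^\alpha}+1\right)^2-\rho\left[\left(\frac{s^\alpha}{\sigma^\alpha}\right)^2+1\right]}{\left[\left(\frac{s^\alpha}{\sigma^\alpha}+1\right)^2-\rho\,\frac{s^\alpha}{\sigma^\alpha}\right]^2}-\frac{1}{\left(\frac{s^\alpha}{\sigma^\alpha}+1\right)^2}\right\},\qquad s=\frac{w}{1-w}.$$ *)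

theory Defs
  imports Complex_Main
begin

text \<open>
  The unit-Frechet density with parameters \<open>\<sigma> > 0\<close>, \<open>\<alpha> > 0\<close>, \<open>0 \<le> \<rho> \<le> 1\<close>. The distribution lives
  on the open interval (0,1), so the density is set to 0 outside of it. Real exponents are rendered
  with \<open>powr\<close>, whose base is positive here because \<open>0 < w < 1\<close> gives \<open>s > 0\<close>.
\<close>

definition unit_frechet_pdf :: "real \<Rightarrow> real \<Rightarrow> real \<Rightarrow> real \<Rightarrow> real" where
  "unit_frechet_pdf \<sigma> \<alpha> \<rho> w =
    (if 0 < w \<and> w < 1 then
       (let s = w / (1 - w); x = s powr \<alpha> / \<sigma> powr \<alpha> in
         \<alpha> / \<sigma> powr \<alpha> * s powr (\<alpha> - 1) * (s + 1)\<^sup>2 *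
           ((2 * (x + 1)\<^sup>2 - \<rho> * (x\<^sup>2 + 1)) / ((x + 1)\<^sup>2 - \<rho> * x)\<^sup>2 - 1 / (x + 1)\<^sup>2))
     else 0)"

end

theory Submission
  imports Defs
begin

text \<open>
  Reflecting \<open>w\<close> in \<open>1/2\<close> inverts the odds \<open>s = w / (1 - w)\<close>, hence also \<open>x = s powr \<alpha>\<close> when
  \<open>\<sigma> = 1\<close>. The expression in braces is multiplied by \<open>x\<^sup>2\<close> under \<open>x \<mapsto> 1/x\<close>, and this is exactly
  the factor \<open>s powr (2 * \<alpha>)\<close> by which the prefactor \<open>s powr (\<alpha> - 1) * (s + 1)\<^sup>2\<close> is divided.
\<close>

text \<open>The three quadratics in \<open>x\<close> involved are palindromic, so putting
  \<open>1/x\<close> for \<open>x\<close> divides each of them by \<open>x\<^sup>2\<close>. Both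
  quotients then gain a factor \<open>x\<^sup>2\<close>, the first because its denominator is
  squared.\<close>

lemma bracket_inverse:
  fixes x \<rho> :: real
  assumes "x > 0"
  shows "(2 * (1/x + 1)\<^sup>2 - \<rho> * ((1/x)\<^sup>2 + 1)) / ((1/x + 1)\<^sup>2 - \<rho> * (1/x))\<^sup>2 - 1 / (1/x + 1)\<^sup>2
    = x\<^sup>2 * ((2 * (x + 1)\<^sup>2 - \<rho> * (x\<^sup>2 + 1)) / ((x + 1)\<^sup>2 - \<rho> * x)\<^sup>2 - 1 / (x + 1)\<^sup>2)"
proof -
  have "2 * (1/x + 1)\<^sup>2 - \<rho> * ((1/x)\<^sup>2 + 1) = (2 * (x + 1)\<^sup>2 - \<rho> * (x\<^sup>2 + 1)) / x\<^sup>2"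
    and "(1/x + 1)\<^sup>2 - \<rho> * (1/x) = ((x + 1)\<^sup>2 - \<rho> * x) / x\<^sup>2"
    and "(1/x + 1)\<^sup>2 = (x + 1)\<^sup>2 / x\<^sup>2"
    using assms by (simp_all add: field_simps power2_eq_square)
  \<comment> \<open>Division by zero gives 0, so this also covers \<open>b = 0\<close> and
    \<open>c = 0\<close>.\<close>
  moreover have "a / x\<^sup>2 / (b / x\<^sup>2)\<^sup>2 - 1 / (c / x\<^sup>2) = x\<^sup>2 * (a / b\<^sup>2 - 1 / c)" for a b c :: real
    using assms by (simp add: power_divide right_diff_distrib power2_eq_square)
  ultimately show ?thesis
    by (simp only:)
qed

text \<open>Apart from \<open>(s + 1)\<^sup>2\<close>, the exponents of \<open>s\<close> on the left
  add up to (1 - \<alpha>) - 2 + 2 \<alpha> = \<alpha> - 1.\<close>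

lemma prefactor_inverse:
  fixes s \<alpha> :: real
  assumes "s > 0"
  shows "(1/s) powr (\<alpha> - 1) * (1/s + 1)\<^sup>2 * (s powr \<alpha>)\<^sup>2 = s powr (\<alpha> - 1) * (s + 1)\<^sup>2"
proof -
  \<comment> \<open>With \<open>s powr \<alpha>\<close> as the only real power left, the claim
    becomes a rational identity.\<close>
  have "(1/s) powr (\<alpha> - 1) = s / s powr \<alpha>" and "s powr (\<alpha> - 1) = s powr \<alpha> / s"
    using assms by (simp_all add: powr_divide powr_diff)
  moreover have "(1/s + 1)\<^sup>2 = (s + 1)\<^sup>2 / s\<^sup>2"
    using assms by (simp add: field_simps power2_eq_square)
  ultimately show ?thesis
    using assms by (simp add: power2_eq_square)
qed

text \<open>In terms of \<open>w\<close> and \<open>1 - w\<close> the odds are plainly reciprocal;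
  \<open>w = 1/2 + \<delta>\<close> gives the symmetry around 1/2.\<close>

lemma unit_frechet_pdf_reflect:
  assumes "0 < w" and "w < 1"
  shows "unit_frechet_pdf 1 \<alpha> \<rho> (1 - w) = unit_frechet_pdf 1 \<alpha> \<rho> w"
proof -
  define s where "s = w / (1 - w)"
  define x where "x = s powr \<alpha>"
  define B where "B y = (2 * (y + 1)\<^sup>2 - \<rho> * (y\<^sup>2 + 1)) / ((y + 1)\<^sup>2 - \<rho> * y)\<^sup>2 - 1 / (y + 1)\<^sup>2"
    for y :: real
  have s: "s > 0" and x: "x > 0"
    using assms by (simp_all add: s_def x_def)
  have odds: "(1 - w) / (1 - (1 - w)) = 1/s" and inv: "(1/s) powr \<alpha> = 1/x"
    using s by (simp_all add: s_def x_def powr_divide)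
  have "unit_frechet_pdf 1 \<alpha> \<rho> (1 - w) = \<alpha> * (1/s) powr (\<alpha> - 1) * (1/s + 1)\<^sup>2 * B (1/x)"
    unfolding unit_frechet_pdf_def Let_def odds inv B_def using assms by simp
  also have "B (1/x) = x\<^sup>2 * B x"
    unfolding B_def by (rule bracket_inverse[OF x])
  \<comment> \<open>The factor \<open>x\<^sup>2\<close> released by the braces moves over to the
    prefactor, which it restores to its form in \<open>s\<close>.\<close>
  also have "\<alpha> * (1/s) powr (\<alpha> - 1) * (1/s + 1)\<^sup>2 * (x\<^sup>2 * B x)
      = \<alpha> * ((1/s) powr (\<alpha> - 1) * (1/s + 1)\<^sup>2 * (s powr \<alpha>)\<^sup>2) * B x"
    by (simp only: x_def mult.assoc)
  also have "\<dots> = \<alpha> * s powr (\<alpha> - 1) * (s + 1)\<^sup>2 * B x"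
    by (simp only: prefactor_inverse[OF s])
  also have "\<dots> = unit_frechet_pdf 1 \<alpha> \<rho> w"
    unfolding unit_frechet_pdf_def Let_def B_def x_def s_def using assms by simp
  finally show ?thesis .
qed

theorem proposition4p2:
  fixes \<sigma> \<alpha> \<rho> :: real
  assumes "\<alpha> > 0" and "0 \<le> \<rho>" and "\<rho> \<le> 1" and "\<sigma> = 1"
  shows "\<forall>\<delta>::real. 0 < \<delta> \<and> \<delta> < 1/2 \<longrightarrow>
    unit_frechet_pdf \<sigma> \<alpha> \<rho> (1/2 - \<delta>) = unit_frechet_pdf \<sigma> \<alpha> \<rho> (1/2 + \<delta>)"
proof (intro allI impI)
  fix \<delta> :: real
  assume "0 < \<delta> \<and> \<delta> < 1/2"
  moreover have "1 - (1/2 + \<delta>) = 1/2 - \<delta>"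
    by simp
  ultimately show "unit_frechet_pdf \<sigma> \<alpha> \<rho> (1/2 - \<delta>) = unit_frechet_pdf \<sigma> \<alpha> \<rho> (1/2 + \<delta>)"
    using unit_frechet_pdf_reflect[of "1/2 + \<delta>" \<alpha> \<rho>] \<open>\<sigma> = 1\<close> by simp
qed

end
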